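(* There exists a universal constant $c>0$ such that for every integer $n\geq 1$ there exists a sequence $(K_j)_{j\in\mathbb{N}}$ of non-empty origin-symmetric convex bodies in $\mathbb{R}^n$ with $$\limsup_{j\rightarrow\infty} \frac{\#(K_j)^{\frac{n-1}{n}}}{\sup_H \#(K_j\cap H)} \geq c\sqrt{n},$$ where $H$ ranges over all affine hyperplanes in $\mathbb{R}^n$.
   Context: A convex body in $\mathbb{R}^n$ is a compact convex set; it is origin-symmetric if $K=-K$. For $M\subseteq\mathbb{R}^n$, $\#(M)=|M\cap\mathbb{Z}^n|$ is the number of integer points in $M$. *)

theory Defs
  imports "HOL-Analysis.Analysis"
begin

text \<open>
  The constant in the theorem does not depend on the dimension, so \<open>n\<close> has to be a bound variable
  and cannot be a type. Hence \<open>\<real>\<^sup>n\<close> is the library's \<^const>\<open>Euclidean_space\<close>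
  \<open>n\<close>: its points are the functions \<open>nat \<Rightarrow> real\<close> that vanish at all indices
  \<open>i \<ge> n\<close>. The function type is not an instance of \<^class>\<open>real_vector\<close>, which is
  why convexity and hyperplanes are spelled out in coordinates.
\<close>

abbreviation R_space :: "nat \<Rightarrow> (nat \<Rightarrow> real) set" where
  "R_space n \<equiv> topspace (Euclidean_space n)"

definition convex_set :: "(nat \<Rightarrow> real) set \<Rightarrow> bool" where
  "convex_set K \<longleftrightarrow>
     (\<forall>x\<in>K. \<forall>y\<in>K. \<forall>u\<ge>0. \<forall>v\<ge>0. u + v = 1 \<longrightarrow> (\<lambda>i. u * x i + v * y i) \<in> K)"

text \<open>Convex bodies may have empty interior; \<^const>\<open>compactin\<close> includes
  \<open>K \<subseteq> R_space n\<close>.\<close>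

definition convex_body :: "nat \<Rightarrow> (nat \<Rightarrow> real) set \<Rightarrow> bool" where
  "convex_body n K \<longleftrightarrow> compactin (Euclidean_space n) K \<and> convex_set K"

definition origin_symmetric :: "(nat \<Rightarrow> real) set \<Rightarrow> bool" where
  "origin_symmetric K \<longleftrightarrow> K = (\<lambda>x i. - x i) ` K"

definition integer_lattice :: "nat \<Rightarrow> (nat \<Rightarrow> real) set" where
  "integer_lattice n = {x \<in> R_space n. \<forall>i. x i \<in> \<int>}"

text \<open>\<^const>\<open>card\<close> is the true cardinality on bounded sets, in particular on subsets of
  convex bodies.\<close>

definition lattice_count :: "nat \<Rightarrow> (nat \<Rightarrow> real) set \<Rightarrow> nat" where
  "lattice_count n M = card (M \<inter> integer_lattice n)"

definition affine_hyperplane :: "nat \<Rightarrow> (nat \<Rightarrow> real) set \<Rightarrow> bool" where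
  "affine_hyperplane n H \<longleftrightarrow>
     (\<exists>a b. a \<in> R_space n \<and> a \<noteq> (\<lambda>_. 0) \<and> H = {x \<in> R_space n. (\<Sum>i<n. a i * x i) = b})"

text \<open>For a convex body \<open>K\<close> the numbers below are bounded by \<open>lattice_count n K\<close>, so
  the supremum in \<open>real\<close> is the true one.\<close>

definition max_hyperplane_count :: "nat \<Rightarrow> (nat \<Rightarrow> real) set \<Rightarrow> real" where
  "max_hyperplane_count n K = (SUP H\<in>{H. affine_hyperplane n H}. real (lattice_count n (K \<inter> H)))"

end

theory Submission
  imports Defs "HOL-Computational_Algebra.Primes"
begin

text \<open>
  The bodies \<open>K j\<close> can all be the same ellipsoid \<open>K\<close>, namely the preimage of a large ball under a
  linear map taking the integer lattice to a lattice \<open>L\<close>. By a Minkowski--Hlawka type counting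
  argument modulo a prime \<open>p\<close>, \<open>L\<close> can be chosen with determinant \<open>p ^ (n - 1)\<close> such that all
  nonzero dual vectors are longer than \<open>c * sqrt n\<close> after normalising the determinant. In a ball of
  radius \<open>R\<close> the lattice points on a hyperplane with a primitive dual vector \<open>z\<close> as normal can be
  pushed towards the origin into about \<open>R * norm z / sqrt n\<close> disjoint parallel copies, and these all
  lie in the ball of radius \<open>(1 + 1 / n) * R\<close>. For suitable \<open>R\<close> that ball contains at most four times
  as many lattice points, and the number of lattice points is at most
  \<open>(C * R / sqrt n) ^ n / p ^ (n - 1)\<close>.
\<close>

subsection \<open>Integer points in balls\<close>

lemma sum_power_abs_le:
  fixes q :: real
  assumes "0 \<le> q" "q < 1"
  shows "(\<Sum>k\<in>{- int M..int M}. q ^ nat \<bar>k\<bar>) \<le> 2 / (1 - q)"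
proof -
  \<comment> \<open>Counting the term \<open>k = 0\<close> twice gives two equal geometric sums;
    this bound, unlike the final one, survives induction on \<open>M\<close>.\<close>
  have "(\<Sum>k\<in>{- int M..int M}. q ^ nat \<bar>k\<bar>) \<le> 2 * (1 - q ^ Suc M) / (1 - q)"
  proof (induction M)
    case 0
    then show ?case using assms by simp
  next
    case (Suc M)
    have eq: "{- int (Suc M)..int (Suc M)} = insert (- int (Suc M)) (insert (int (Suc M)) {- int M..int M})"
      by auto
    have "(\<Sum>k\<in>{- int (Suc M)..int (Suc M)}. q ^ nat \<bar>k\<bar>)
        = 2 * q ^ Suc M + (\<Sum>k\<in>{- int M..int M}. q ^ nat \<bar>k\<bar>)"
      unfolding eq by (subst sum.insert, simp, simp)+ (simp add: nat_add_distrib add.commute)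
    also have "\<dots> \<le> 2 * q ^ Suc M + 2 * (1 - q ^ Suc M) / (1 - q)"
      using Suc by simp
    also have "\<dots> = 2 * (1 - q ^ Suc (Suc M)) / (1 - q)"
      using assms by (simp add: divide_simps) (simp add: algebra_simps)
    finally show ?case .
  qed
  also have "\<dots> \<le> 2 / (1 - q)"
    using assms by (intro divide_right_mono) auto
  finally show ?thesis .
qed

text \<open>From \<open>exp (1 / r) \<ge> 1 + 1 / r\<close> one gets
  \<open>1 - q \<ge> 1 / (r + 1) \<ge> 1 / (2 * r)\<close> for the ratio
  \<open>q = exp (- 1 / r)\<close> of the geometric series.\<close>

lemma sum_exp_abs_le:
  fixes r :: real
  assumes "r \<ge> 1"
  shows "(\<Sum>k\<in>{- int M..int M}. exp (- \<bar>of_int k\<bar> / r)) \<le> 4 * r"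
proof -
  define q where "q = exp (- 1 / r)"
  have q: "0 \<le> q" "q < 1" using assms by (auto simp: q_def)
  have "exp (- \<bar>of_int k\<bar> / r) = q ^ nat \<bar>k\<bar>" for k :: int
    by (simp add: q_def flip: exp_of_nat_mult)
  then have "(\<Sum>k\<in>{- int M..int M}. exp (- \<bar>of_int k\<bar> / r)) \<le> 2 / (1 - q)"
    using sum_power_abs_le[OF q] by simp
  also have "\<dots> \<le> 4 * r"
  proof -
    have "1 + 1 / r \<le> exp (1 / r)" by (rule exp_ge_add_one_self)
    then have "q * (1 + 1 / r) \<le> 1"
      by (simp add: q_def exp_minus field_simps)
    then have "q * (r + 1) \<le> r"
      using assms by (simp add: field_simps)
    then have "1 \<le> (1 - q) * (r + 1)" by (simp add: algebra_simps)
    also have "\<dots> \<le> (1 - q) * (2 * r)" using assms q by (intro mult_left_mono) auto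
    finally show ?thesis using q by (simp add: field_simps)
  qed
  finally show ?thesis .
qed

lemma integer_lattice_iff:
  "x \<in> integer_lattice n \<longleftrightarrow> (\<forall>i\<ge>n. x i = 0) \<and> (\<forall>i. x i \<in> \<int>)"
  by (auto simp: integer_lattice_def topspace_Euclidean_space)

lemma integer_latticeI:
  assumes "\<And>i. i \<ge> n \<Longrightarrow> x i = 0" "\<And>i. i < n \<Longrightarrow> x i \<in> \<int>"
  shows "x \<in> integer_lattice n"
  unfolding integer_lattice_iff by (metis Ints_0 assms not_le)

lemma integer_lattice_add:
  assumes "x \<in> integer_lattice n" "y \<in> integer_lattice n"
  shows "(\<lambda>i. x i + y i) \<in> integer_lattice n"
  using assms by (auto simp: integer_lattice_iff)

text \<open>Exponential weights: by Cauchy--Schwarz a point of the ball has l1 norm at most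
  \<open>n * r\<close>, so its weight \<open>exp (n - l1 / r)\<close> is at least 1. Summed over a
  box of integer points, the weights factor into \<open>n\<close> one-dimensional sums, each at most
  \<open>exp 1 * (4 * r) \<le> 12 * r\<close>.\<close>

lemma lattice_ball_count:
  fixes r :: real
  assumes r: "r \<ge> 1"
  shows "finite {x \<in> integer_lattice n. L2_set x {..<n} \<le> sqrt n * r}" (is "finite ?Z")
    and "card {x \<in> integer_lattice n. L2_set x {..<n} \<le> sqrt n * r} \<le> (12 * r) ^ n"
proof -
  define M where "M = nat \<lceil>n * r\<rceil>"
  define B where "B = PiE {..<n} (\<lambda>_. {- int M..int M})"
  \<comment> \<open>Extensional integer functions, so that \<open>prod_sum_PiE\<close> can exchange
    the sum over the box with the product.\<close>
  define \<phi> where "\<phi> x = restrict (\<lambda>i. \<lfloor>x i\<rfloor>) {..<n}" for x :: "nat \<Rightarrow> real"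
  define G where "G y = (\<Prod>i<n. exp 1 * exp (- \<bar>of_int (y i)\<bar> / r))" for y :: "nat \<Rightarrow> int"
  have l1: "(\<Sum>i<n. \<bar>x i\<bar>) \<le> n * r" if "x \<in> ?Z" for x
  proof -
    have "(\<Sum>i<n. \<bar>x i\<bar>) = (\<Sum>i<n. \<bar>x i\<bar> * \<bar>1\<bar>)" by simp
    also have "\<dots> \<le> L2_set x {..<n} * L2_set (\<lambda>_. 1) {..<n}"
      by (rule L2_set_mult_ineq)
    also have "\<dots> \<le> (sqrt n * r) * sqrt n"
      using that r by (intro mult_mono) (auto simp: L2_set_def intro!: sum_nonneg)
    also have "\<dots> = n * r" by (simp add: mult.commute mult.left_commute)
    finally show ?thesis .
  qed
  have floor: "of_int \<lfloor>x i\<rfloor> = x i" if "x \<in> ?Z" for x i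
    using that by (auto simp: integer_lattice_iff elim!: Ints_cases)
  have inj: "inj_on \<phi> ?Z"
  proof (rule inj_onI, rule ext)
    fix x y i assume *: "x \<in> ?Z" "y \<in> ?Z" "\<phi> x = \<phi> y"
    show "x i = y i"
    proof (cases "i < n")
      case True
      then have "\<lfloor>x i\<rfloor> = \<lfloor>y i\<rfloor>" using fun_cong[OF *(3), of i] by (simp add: \<phi>_def)
      then show ?thesis using floor * by metis
    qed (use * in \<open>auto simp: integer_lattice_iff\<close>)
  qed
  have sub: "\<phi> ` ?Z \<subseteq> B"
  proof
    fix y assume "y \<in> \<phi> ` ?Z"
    then obtain x where x: "x \<in> ?Z" "y = \<phi> x" by auto
    have "\<lfloor>x i\<rfloor> \<in> {- int M..int M}" if "i < n" for i
    proof -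
      have "\<bar>x i\<bar> \<le> (\<Sum>i<n. \<bar>x i\<bar>)"
        using that by (intro member_le_sum) auto
      then have "\<bar>of_int \<lfloor>x i\<rfloor>\<bar> \<le> n * r" using l1[OF x(1)] by (subst floor[OF x(1)]) linarith
      also have "\<dots> \<le> real M" using r by (simp add: M_def)
      finally show ?thesis by auto
    qed
    then show "y \<in> B" by (auto simp: x B_def \<phi>_def)
  qed
  have finB: "finite B" by (auto simp: B_def intro!: finite_PiE)
  show fin: "finite ?Z" using inj sub finB by (meson finite_imageD finite_subset)
  have "real (card ?Z) = (\<Sum>x\<in>?Z. 1)" by simp
  also have "\<dots> \<le> (\<Sum>x\<in>?Z. G (\<phi> x))"
  proof (rule sum_mono)
    fix x assume x: "x \<in> ?Z"
    have "1 \<le> exp (n - (\<Sum>i<n. \<bar>x i\<bar>) / r)"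
      using l1[OF x] r by (simp add: field_simps)
    also have "n - (\<Sum>i<n. \<bar>x i\<bar>) / r = (\<Sum>i<n. 1 - \<bar>x i\<bar> / r)"
      by (simp add: sum_subtractf sum_divide_distrib)
    also have "exp \<dots> = (\<Prod>i<n. exp (1 - \<bar>x i\<bar> / r))"
      by (simp add: exp_sum)
    also have "\<dots> = G (\<phi> x)"
      unfolding G_def by (rule prod.cong) (auto simp: \<phi>_def floor[OF x] simp flip: exp_add)
    finally show "1 \<le> G (\<phi> x)" .
  qed
  also have "\<dots> = (\<Sum>y\<in>\<phi> ` ?Z. G y)" using inj by (simp add: sum.reindex)
  also have "\<dots> \<le> (\<Sum>y\<in>B. G y)"
    by (intro sum_mono2 finB sub) (auto simp: G_def intro!: prod_nonneg)
  also have "\<dots> = (\<Prod>i<n. \<Sum>k\<in>{- int M..int M}. exp 1 * exp (- \<bar>of_int k\<bar> / r))"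
    unfolding B_def G_def by (subst prod_sum_PiE) auto
  also have "\<dots> \<le> (\<Prod>i<n. 12 * r)"
  proof (rule prod_mono)
    fix i
    have "(\<Sum>k\<in>{- int M..int M}. exp 1 * exp (- \<bar>of_int k\<bar> / r)) \<le> 3 * (4 * r)"
      unfolding sum_distrib_left[symmetric]
      by (intro mult_mono sum_exp_abs_le exp_le r sum_nonneg) auto
    then show "0 \<le> (\<Sum>k\<in>{- int M..int M}. exp 1 * exp (- \<bar>of_int k\<bar> / r)) \<and>
      (\<Sum>k\<in>{- int M..int M}. exp 1 * exp (- \<bar>of_int k\<bar> / r)) \<le> 12 * r"
      by (auto intro!: sum_nonneg)
  qed
  also have "\<dots> = (12 * r) ^ n" by simp
  finally show "card ?Z \<le> (12 * r) ^ n" .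
qed

subsection \<open>A lattice whose dual has no short vectors\<close>

text \<open>If \<open>p\<close> does not divide \<open>z i\<close>, the other coordinates of a
  solution determine \<open>u i\<close> modulo \<open>p\<close>, so overwriting \<open>u i\<close>
  by an arbitrary residue is injective on pairs. If every \<open>z i\<close> is divisible, there is
  no solution at all. The factor \<open>nat p\<close> on the left avoids the exponent
  \<open>card I - 1\<close>.\<close>

lemma card_linear_congruence_le:
  fixes p c :: int and z :: "'a \<Rightarrow> int"
  assumes p: "prime p" and I: "finite I"
    and ndvd: "\<not> (p dvd c \<and> (\<forall>i\<in>I. p dvd z i))"
  shows "card {u \<in> I \<rightarrow>\<^sub>E {0..<p}. p dvd c + (\<Sum>i\<in>I. u i * z i)} * nat p \<le> nat p ^ card I"
    (is "card ?S * _ \<le> _")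
proof (cases "\<forall>i\<in>I. p dvd z i")
  case True
  then have "p dvd (\<Sum>i\<in>I. u i * z i)" for u by (auto intro!: dvd_sum)
  then have "?S = {}" using ndvd True by (auto simp: dvd_add_left_iff)
  then show ?thesis by (metis (no_types, lifting) card.empty mult_0 zero_le)
next
  case False
  then obtain i where i: "i \<in> I" "\<not> p dvd z i" by auto
  have split: "(\<Sum>j\<in>I. u j * z j) = u i * z i + (\<Sum>j\<in>I-{i}. u j * z j)" for u
    using i I by (simp add: sum.remove)
  have inj: "inj_on (\<lambda>(u, t). u(i := t)) (?S \<times> {0..<p})"
  proof (rule inj_onI, clarify)
    fix u v s t
    assume u: "u \<in> I \<rightarrow>\<^sub>E {0..<p}" "p dvd c + (\<Sum>i\<in>I. u i * z i)"
      and v: "v \<in> I \<rightarrow>\<^sub>E {0..<p}" "p dvd c + (\<Sum>i\<in>I. v i * z i)"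
      and eq: "u(i := s) = v(i := t)"
    have st: "s = t" using fun_cong[OF eq, of i] by simp
    have off: "u j = v j" if "j \<noteq> i" for j using fun_cong[OF eq, of j] that by simp
    have "p dvd (c + (\<Sum>i\<in>I. u i * z i)) - (c + (\<Sum>i\<in>I. v i * z i))"
      using u v by (intro dvd_diff)
    also have "\<dots> = (u i - v i) * z i"
      unfolding split using off by (simp add: algebra_simps)
    finally have "p dvd u i - v i" using i p by (simp add: prime_dvd_mult_iff)
    moreover have "\<bar>u i - v i\<bar> < p" using u(1) v(1) i(1) by (auto simp: PiE_def Pi_def abs_less_iff) (smt (verit))+
    ultimately have "u i = v i"
      using zdvd_not_zless[of "\<bar>u i - v i\<bar>" p] by fastforce
    then show "u = v \<and> s = t" using off st by (metis ext)
  qed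
  have "card ?S * nat p = card (?S \<times> {0..<p})" by (simp add: card_cartesian_product)
  also have "\<dots> \<le> card (I \<rightarrow>\<^sub>E {0..<p})"
    using i I by (intro card_inj_on_le[OF inj] finite_PiE) (auto simp: PiE_def extensional_def)
  also have "\<dots> = nat p ^ card I" using I by (simp add: card_PiE)
  finally show ?thesis .
qed

text \<open>A random \<open>u\<close> modulo \<open>p\<close> works, because fewer than \<open>p\<close> nonzero integer points lie in the
  ball of radius \<open>sqrt n * r\<close> and each of them is annihilated with probability at most \<open>1 / p\<close>.\<close>

lemma exists_dual_gap:
  assumes n: "n \<ge> (1::nat)"
  obtains p :: int and u :: "nat \<Rightarrow> int" and r :: real
  where "prime p" "u 0 = 1" "r \<ge> 1" "(12 * r) ^ n = p"
    "\<And>x m. x \<in> integer_lattice n \<Longrightarrow> x \<noteq> (\<lambda>_. 0) \<Longrightarrow> (\<Sum>i<n. of_int (u i) * x i) = of_int p * of_int m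
       \<Longrightarrow> sqrt n * r < L2_set x {..<n}"
proof -
  \<comment> \<open>A prime above \<open>12 ^ n\<close> gives \<open>r \<ge> 1\<close>, and
    \<open>(12 * r) ^ n = p\<close> makes the bound for the integer points of the ball exactly
    \<open>p\<close>. The origin is one of them, so fewer than \<open>p\<close> are nonzero.\<close>
  obtain p0 :: nat where p0: "prime p0" "p0 > 12 ^ n" using bigger_prime by blast
  define p where "p = int p0"
  have p: "prime p" using p0 by (simp add: p_def)
  define r where "r = root n p / 12"
  have rn: "(12 * r) ^ n = p" using n by (simp add: r_def p_def)
  have "real (12 ^ n) \<le> real p0" using p0(2) by (intro of_nat_mono) simp
  then have "root n (12 ^ n) \<le> root n p" using n unfolding p_def
    by (intro real_root_le_mono) auto
  then have r: "r \<ge> 1" using n by (simp add: r_def real_root_power_cancel)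
  \<comment> \<open>Coordinates of points of the ball are smaller than \<open>p\<close>, so a
    nonzero one is not divisible by \<open>p\<close> and the congruence in \<open>Bad\<close> is
    never trivial.\<close>
  have small: "sqrt n * r < p"
  proof (cases "n = 1")
    case True
    then show ?thesis using rn r by simp
  next
    case False
    have n12: "n < 12 ^ n" by (rule less_exp[THEN less_le_trans]) (simp add: power_mono)
    have "r * r \<le> r ^ n"
      using power_increasing[of 2 n r] False n r by (simp add: power2_eq_square)
    also have "r ^ n = p / 12 ^ n" using rn by (simp add: field_simps)
    finally have "n * (r * r) \<le> n * (p / 12 ^ n)"
      by (intro mult_left_mono) auto
    then have "(sqrt n * r)^2 \<le> n * (p / 12 ^ n)"
      by (simp add: power_mult_distrib flip: power2_eq_square)
    also have "\<dots> < p * 1"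
    proof -
      have "real n < 12 ^ n" using n12 by (metis of_nat_less_iff of_nat_numeral of_nat_power)
      then show ?thesis using prime_gt_0_int[OF p] by (simp add: field_simps)
    qed
    also have "\<dots> \<le> p^2" using prime_gt_1_int[OF p] by (simp add: power2_eq_square)
    finally show ?thesis using prime_gt_0_int[OF p] by (simp add: power2_less_imp_less)
  qed
  define Z where "Z = {x \<in> integer_lattice n. L2_set x {..<n} \<le> sqrt n * r}"
  \<comment> \<open>Coefficient 0 is fixed to be 1 and stands outside the sum; only the other
    \<open>n - 1\<close> are random.\<close>
  define Bad where "Bad x = {u \<in> {1..<n} \<rightarrow>\<^sub>E {0..<p}. p dvd \<lfloor>x 0\<rfloor> + (\<Sum>i\<in>{1..<n}. u i * \<lfloor>x i\<rfloor>)}"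
    for x :: "nat \<Rightarrow> real"
  have finZ: "finite Z" and cardZ: "card Z \<le> p"
    using lattice_ball_count[OF r, of n] rn by (auto simp: Z_def)
  have zero: "(\<lambda>_. 0) \<in> Z" using r by (auto simp: Z_def integer_lattice_iff L2_set_def)
  have Bad: "card (Bad x) * nat p \<le> nat p ^ (n - 1)" if x: "x \<in> Z - {\<lambda>_. 0}" for x
  proof -
    have "\<not> (p dvd \<lfloor>x 0\<rfloor> \<and> (\<forall>i\<in>{1..<n}. p dvd \<lfloor>x i\<rfloor>))"
    proof
      assume *: "p dvd \<lfloor>x 0\<rfloor> \<and> (\<forall>i\<in>{1..<n}. p dvd \<lfloor>x i\<rfloor>)"
      have "x i = 0" for i
      proof (cases "i < n")
        case True
        then have "p dvd \<lfloor>x i\<rfloor>" using * by (cases "i = 0") auto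
        moreover have xi: "of_int \<lfloor>x i\<rfloor> = x i"
          using x by (auto simp: Z_def integer_lattice_iff elim!: Ints_cases)
        moreover have "\<bar>x i\<bar> < p"
          using member_le_L2_set[of "{..<n}" i "\<lambda>i. \<bar>x i\<bar>"] True x small by (auto simp: Z_def L2_set_def)
        then have "\<bar>\<lfloor>x i\<rfloor>\<bar> < p" using xi by linarith
        ultimately have "\<lfloor>x i\<rfloor> = 0" using zdvd_not_zless[of "\<bar>\<lfloor>x i\<rfloor>\<bar>" p] by fastforce
        then show ?thesis using xi by simp
      qed (use x in \<open>auto simp: Z_def integer_lattice_iff\<close>)
      then show False using x by auto
    qed
    from card_linear_congruence_le[OF p _ this] show ?thesis by (simp add: Bad_def)
  qed
  have p1: "nat p > 0" using prime_gt_0_int[OF p] by simp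
  have "card (\<Union>x\<in>Z - {\<lambda>_. 0}. Bad x) * nat p \<le> (\<Sum>x\<in>Z - {\<lambda>_. 0}. card (Bad x)) * nat p"
    using finZ by (intro mult_right_mono card_UN_le) auto
  also have "\<dots> \<le> (\<Sum>x\<in>Z - {\<lambda>_. 0}. nat p ^ (n - 1))"
    unfolding sum_distrib_right by (intro sum_mono Bad)
  also have "\<dots> = (card Z - 1) * nat p ^ (n - 1)" using finZ zero by simp
  also have "\<dots> < nat p * nat p ^ (n - 1)"
    using cardZ p1 by (intro mult_strict_right_mono) auto
  finally have "card (\<Union>x\<in>Z - {\<lambda>_. 0}. Bad x) < nat p ^ (n - 1)"
    using p1 by (simp add: mult.commute)
  also have "\<dots> = card ({1..<n} \<rightarrow>\<^sub>E {0..<p})" by (simp add: card_PiE)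
  finally have "\<not> ({1..<n} \<rightarrow>\<^sub>E {0..<p}) \<subseteq> (\<Union>x\<in>Z - {\<lambda>_. 0}. Bad x)"
    using finZ by (intro notI) (drule card_mono[rotated], auto simp: Bad_def finite_PiE)
  then obtain u where u: "u \<in> {1..<n} \<rightarrow>\<^sub>E {0..<p}" "\<And>x. x \<in> Z \<Longrightarrow> x \<noteq> (\<lambda>_. 0) \<Longrightarrow> u \<notin> Bad x"
    by blast
  show thesis
  proof (rule that[of p "u(0 := 1)" r])
    fix x :: "nat \<Rightarrow> real" and m
    assume x: "x \<in> integer_lattice n" "x \<noteq> (\<lambda>_. 0)"
      and eq: "(\<Sum>i<n. of_int ((u(0 := 1)) i) * x i) = of_int p * of_int m"
    have xi: "of_int \<lfloor>x i\<rfloor> = x i" for i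
      using x by (auto simp: integer_lattice_iff elim!: Ints_cases)
    have "(\<Sum>i<n. of_int ((u(0 := 1)) i) * x i) = x 0 + (\<Sum>i\<in>{1..<n}. u i * x i)"
      using n by (simp add: lessThan_atLeast0 sum.atLeast_Suc_lessThan)
    also have "\<dots> = of_int (\<lfloor>x 0\<rfloor> + (\<Sum>i\<in>{1..<n}. u i * \<lfloor>x i\<rfloor>))"
      by (simp add: xi)
    finally have "real_of_int (\<lfloor>x 0\<rfloor> + (\<Sum>i\<in>{1..<n}. u i * \<lfloor>x i\<rfloor>)) = of_int (p * m)"
      unfolding eq by simp
    then have "\<lfloor>x 0\<rfloor> + (\<Sum>i\<in>{1..<n}. u i * \<lfloor>x i\<rfloor>) = p * m"
      by (rule of_int_eq_iff[THEN iffD1])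
    then have "u \<in> Bad x" using u(1) by (simp add: Bad_def)
    then have "x \<notin> Z" using u(2) x(2) by blast
    then show "sqrt n * r < L2_set x {..<n}" using x(1) by (simp add: Z_def)
  qed (use p r rn in auto)
qed

subsection \<open>Lattice points in ellipsoids\<close>

text \<open>The vectors \<open>x / p\<close> with \<open>x\<close> as in \<open>gap\<close> form the dual of the lattice of all \<open>skew y\<close>, where
  \<open>y\<close> is an integer vector.\<close>

locale skew_lattice =
  fixes n :: nat and p :: int and u :: "nat \<Rightarrow> int" and r :: real
  assumes n_pos: "n \<ge> 1" and p_pos: "p > 0" and u_0: "u 0 = 1" and r_pos: "r > 0"
    and gap: "\<And>x m. x \<in> integer_lattice n \<Longrightarrow> x \<noteq> (\<lambda>_. 0) \<Longrightarrow>
      (\<Sum>i<n. of_int (u i) * x i) = of_int p * of_int m \<Longrightarrow> sqrt n * r < L2_set x {..<n}"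
begin

text \<open>A triangular matrix with first column \<open>u\<close> and \<open>p\<close> on the rest
  of the diagonal, hence of determinant \<open>p ^ (n - 1)\<close>. It maps the integer points onto
  the integer points that are congruent to a multiple of \<open>u\<close> modulo
  \<open>p\<close>.\<close>

definition skew :: "(nat \<Rightarrow> real) \<Rightarrow> nat \<Rightarrow> real" where
  "skew x i = of_int (u i) * x 0 + (if i = 0 then 0 else of_int p * x i)"

definition qnorm :: "(nat \<Rightarrow> real) \<Rightarrow> real" where
  "qnorm x = L2_set (skew x) {..<n}"

definition lball :: "real \<Rightarrow> (nat \<Rightarrow> real) set" where
  "lball R = {x \<in> integer_lattice n. qnorm x \<le> R}"

definition slice :: "(nat \<Rightarrow> real) \<Rightarrow> real \<Rightarrow> real \<Rightarrow> (nat \<Rightarrow> real) set" where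
  "slice a b R = {x \<in> lball R. (\<Sum>i<n. a i * x i) = b}"

text \<open>A crude operator norm, bounding \<open>qnorm\<close> by the largest coordinate. It
  enters only thresholds for \<open>R\<close> and the choice of \<open>T\<close>, so its size does
  not affect the final constant.\<close>

definition skew_bound :: real where
  "skew_bound = (\<Sum>i<n. of_int (\<bar>u i\<bar> + p))"

lemma skew_add: "skew (\<lambda>i. x i + y i) = (\<lambda>i. skew x i + skew y i)"
  by (auto simp: skew_def algebra_simps)

lemma skew_scale: "skew (\<lambda>i. c * x i) = (\<lambda>i. c * skew x i)"
  by (auto simp: skew_def algebra_simps)

lemma qnorm_triangle: "qnorm (\<lambda>i. x i + y i) \<le> qnorm x + qnorm y"
  unfolding qnorm_def skew_add by (rule L2_set_triangle_ineq)

lemma qnorm_scale: "qnorm (\<lambda>i. c * x i) = \<bar>c\<bar> * qnorm x"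
  unfolding qnorm_def skew_scale L2_set_def
  by (simp add: power_mult_distrib real_sqrt_mult flip: sum_distrib_left)

lemma qnorm_zero [simp]: "qnorm (\<lambda>_. 0) = 0"
  by (auto simp: qnorm_def skew_def L2_set_def intro!: sum.neutral)

lemma skew_bound_pos: "skew_bound > 0"
proof -
  have "0 < real_of_int (\<bar>u i\<bar> + p)" for i
    using p_pos by (simp only: of_int_0_less_iff)
  then show ?thesis
    unfolding skew_bound_def using n_pos by (intro sum_pos) (auto simp: lessThan_empty_iff)
qed

lemma qnorm_le:
  assumes "\<And>i. i < n \<Longrightarrow> \<bar>x i\<bar> \<le> d"
  shows "qnorm x \<le> d * skew_bound"
proof -
  have "qnorm x \<le> (\<Sum>i<n. \<bar>skew x i\<bar>)"
    unfolding qnorm_def by (rule L2_set_le_sum_abs)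
  also have "\<dots> \<le> (\<Sum>i<n. d * of_int (\<bar>u i\<bar> + p))"
  proof (rule sum_mono)
    fix i assume i: "i \<in> {..<n}"
    have d: "0 \<le> d" using assms[of 0] n_pos by linarith
    have "\<bar>skew x i\<bar> \<le> \<bar>u i\<bar> * \<bar>x 0\<bar> + p * \<bar>x i\<bar>"
      unfolding skew_def using p_pos by (intro order_trans[OF abs_triangle_ineq] add_mono) (auto simp: abs_mult)
    also have "\<dots> \<le> \<bar>u i\<bar> * d + p * d"
      using p_pos i n_pos by (intro add_mono mult_left_mono assms) auto
    finally show "\<bar>skew x i\<bar> \<le> d * of_int (\<bar>u i\<bar> + p)" by (simp add: algebra_simps)
  qed
  finally show ?thesis by (simp add: skew_bound_def sum_distrib_left)
qed

lemma zero_in_lball: "R \<ge> 0 \<Longrightarrow> (\<lambda>_. 0) \<in> lball R"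
  by (auto simp: lball_def integer_lattice_iff)

text \<open>The points \<open>skew x\<close>, shifted by residues \<open>c i\<close> in
  \<open>{0..<p}\<close> at the indices \<open>1 \<le> i < n\<close>, are distinct, since division
  with remainder recovers \<open>x\<close> and \<open>c\<close>. For \<open>R \<ge> n * p\<close>
  they lie in the ball of radius \<open>2 * R\<close>, which doubles the constant 12 of
  \<open>lattice_ball_count\<close>.\<close>

lemma
  fixes R :: real
  shows finite_lball: "finite (lball R)"
    and card_lball_le: "R \<ge> real n * of_int p \<Longrightarrow>
      real (card (lball R)) * of_int p ^ (n - 1) \<le> (24 * R / sqrt n) ^ n"
proof -
  define C where "C = {1..<n} \<rightarrow>\<^sub>E {0..<p}"
  define W where "W R = {y \<in> integer_lattice n. L2_set y {..<n} \<le> sqrt n * (2 * R / sqrt n)}" for R :: real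
  define f where "f = (\<lambda>(x, c) i. if i < n then skew x i + (if i = 0 then 0 else real_of_int (c i)) else 0)"
  have inj: "inj_on f (lball R \<times> C)" for R
  proof (rule inj_onI, clarify)
    fix x c y d
    assume x: "x \<in> lball R" and y: "y \<in> lball R" and c: "c \<in> C" and d: "d \<in> C"
      and eq: "f (x, c) = f (y, d)"
    have xy0: "x 0 = y 0"
      using fun_cong[OF eq, of 0] n_pos by (simp add: f_def skew_def u_0)
    have cd: "x i = y i \<and> c i = d i" if i: "i \<in> {1..<n}" for i
    proof -
      have e: "of_int p * x i + of_int (c i) = of_int p * y i + of_int (d i)"
        using fun_cong[OF eq, of i] i xy0 by (simp add: f_def skew_def)
      obtain k l where kl: "x i = of_int k" "y i = of_int l"
        using x y by (auto simp: lball_def integer_lattice_iff) (meson Ints_cases)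
      have "real_of_int (p * k + c i) = of_int (p * l + d i)" using e unfolding kl by simp
      then have eq': "p * k + c i = p * l + d i" by (rule of_int_eq_iff[THEN iffD1])
      have "c i \<in> {0..<p}" "d i \<in> {0..<p}" using c d i by (auto simp: C_def)
      then have "(p * k + c i) div p = k" "(p * l + d i) div p = l"
        using p_pos by simp_all
      then have "k = l" using eq' by simp
      then show ?thesis using kl eq' by simp
    qed
    have "x i = y i" for i
      using xy0 cd[of i] x y by (cases "i = 0"; cases "i < n") (auto simp: lball_def integer_lattice_iff)
    moreover have "c i = d i" for i
      using cd[of i] c d by (cases "i \<in> {1..<n}") (auto simp: C_def PiE_def extensional_def)
    ultimately show "x = y \<and> c = d" by auto
  qed
  have sub: "f ` (lball R \<times> C) \<subseteq> W R" if R: "R \<ge> real n * of_int p" for R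
  proof clarify
    fix x c assume x: "x \<in> lball R" and c: "c \<in> C"
    have "L2_set (f (x, c)) {..<n} = L2_set (\<lambda>i. skew x i + (if i = 0 then 0 else real_of_int (c i))) {..<n}"
      by (rule L2_set_cong) (auto simp: f_def)
    also have "\<dots> \<le> qnorm x + L2_set (\<lambda>i. if i = 0 then 0 else real_of_int (c i)) {..<n}"
      unfolding qnorm_def by (rule L2_set_triangle_ineq)
    also have "L2_set (\<lambda>i. if i = 0 then 0 else real_of_int (c i)) {..<n}
        \<le> (\<Sum>i<n. \<bar>if i = 0 then 0 else real_of_int (c i)\<bar>)"
      by (rule L2_set_le_sum_abs)
    also have "\<dots> \<le> (\<Sum>i<n. real_of_int p)"
    proof (rule sum_mono)
      fix i assume "i \<in> {..<n}"
      then have "i = 0 \<or> c i \<in> {0..<p}" using c by (cases "i = 0") (auto simp: C_def PiE_iff)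
      then show "\<bar>if i = 0 then 0 else real_of_int (c i)\<bar> \<le> of_int p" using p_pos by auto
    qed
    also have "\<dots> \<le> R" using R by simp
    finally have "L2_set (f (x, c)) {..<n} \<le> 2 * R" using x by (simp add: lball_def)
    moreover have "f (x, c) \<in> integer_lattice n"
      using x by (intro integer_latticeI) (auto simp: f_def skew_def lball_def integer_lattice_iff)
    ultimately show "f (x, c) \<in> W R" using n_pos by (simp add: W_def)
  qed
  have large: "2 * R / sqrt n \<ge> 1" if R: "R \<ge> real n * of_int p" for R
  proof -
    have "sqrt n \<le> real n * 1" using n_pos by (simp add: real_sqrt_le_iff real_le_lsqrt power2_eq_square)
    also have "\<dots> \<le> real n * of_int p" using p_pos by (intro mult_left_mono) auto
    also have "\<dots> \<le> 2 * R" using R \<open>sqrt n \<le> real n * 1\<close> calculation by (smt (verit) real_sqrt_ge_zero of_nat_0_le_iff)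
    finally show ?thesis using n_pos by simp
  qed
  have fin: "finite (lball R)" if R: "R \<ge> real n * of_int p" for R
  proof -
    have "finite (lball R \<times> C)"
      using inj sub[OF R] lattice_ball_count(1)[OF large[OF R], of n] unfolding W_def
      by (meson finite_imageD finite_subset)
    moreover have "C \<noteq> {}" using p_pos by (auto simp: C_def PiE_eq_empty_iff)
    ultimately show ?thesis by (rule finite_cartesian_productD1)
  qed
  show "finite (lball R)"
    by (rule finite_subset[OF _ fin[of "max R (real n * of_int p)"]]) (auto simp: lball_def)
  show "real (card (lball R)) * of_int p ^ (n - 1) \<le> (24 * R / sqrt n) ^ n" if R: "R \<ge> real n * of_int p"
  proof -
    have "card (lball R) * nat p ^ (n - 1) = card (lball R \<times> C)"
      by (simp add: card_cartesian_product C_def card_PiE)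
    also have "\<dots> \<le> card (W R)"
      using lattice_ball_count(1)[OF large[OF R], of n] unfolding W_def[symmetric]
      by (intro card_inj_on_le[OF inj sub[OF R]])
    finally have "real (card (lball R) * nat p ^ (n - 1)) \<le> real (card (W R))" by (rule of_nat_mono)
    also have "\<dots> \<le> (12 * (2 * R / sqrt n)) ^ n"
      unfolding W_def by (rule lattice_ball_count(2)[OF large[OF R]])
    finally show ?thesis using p_pos by simp
  qed
qed

text \<open>Otherwise the counting function would grow like \<open>4 ^ k\<close> along the radii
  \<open>(1 + 1 / n) ^ k\<close>, whereas it is at most of order \<open>((1 + 1 / n) ^ n) ^ k \<le> 3 ^ k\<close>.\<close>

lemma exists_doubling_radius:
  "\<exists>R\<ge>R0. real (card (lball ((1 + 1 / n) * R))) \<le> 4 * real (card (lball R))"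
proof (rule ccontr)
  assume no_radius: "\<not> (\<exists>R\<ge>R0. real (card (lball ((1 + 1 / n) * R))) \<le> 4 * real (card (lball R)))"
  then have grow: "4 * real (card (lball R)) < card (lball ((1 + 1 / n) * R))" if "R \<ge> R0" for R
    using no_radius that by (meson not_le)
  define g where "g = 1 + 1 / real n"
  \<comment> \<open>From \<open>n * p\<close> on, \<open>card_lball_le\<close> is available at every
    radius \<open>g ^ k * R1\<close>.\<close>
  define R1 where "R1 = max R0 (real n * of_int p)"
  have g: "g \<ge> 1" by (simp add: g_def)
  have R1: "R1 \<ge> R0" "R1 \<ge> real n * of_int p" by (auto simp: R1_def)
  have "0 \<le> real n * of_int p" using p_pos by simp
  then have R1_nonneg: "R1 \<ge> 0" using R1 by linarith
  have up: "g ^ k * R1 \<ge> R1" for k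
    using g R1_nonneg by (simp add: mult_le_cancel_right1 one_le_power)
  have low: "4 ^ k \<le> real (card (lball (g ^ k * R1)))" for k
  proof (induction k)
    case 0
    have "card (lball R1) \<noteq> 0" using zero_in_lball[OF R1_nonneg] finite_lball by auto
    then show ?case by simp
  next
    case (Suc k)
    then have "4 ^ Suc k \<le> 4 * real (card (lball (g ^ k * R1)))" by simp
    also have "\<dots> \<le> card (lball (g * (g ^ k * R1)))"
      unfolding g_def[symmetric] using grow[of "g ^ k * R1"] up[of k] R1 by (simp add: g_def)
    finally show ?case by (simp add: mult.assoc)
  qed
  have gn: "g ^ n \<le> 3"
    unfolding g_def using n_pos by (intro order_trans[OF exp_ge_one_plus_x_over_n_power_n exp_le]) auto
  define M where "M = (24 * R1 / sqrt n) ^ n"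
  have "4 ^ k \<le> M * 3 ^ k" for k
  proof -
    have "4 ^ k \<le> real (card (lball (g ^ k * R1))) * 1" using low by simp
    also have "\<dots> \<le> real (card (lball (g ^ k * R1))) * of_int p ^ (n - 1)"
      using p_pos by (intro mult_left_mono one_le_power) auto
    also have "\<dots> \<le> (24 * (g ^ k * R1) / sqrt n) ^ n"
      using up[of k] R1 by (intro card_lball_le) auto
    also have "\<dots> = (24 * R1 / sqrt n * g ^ k) ^ n" by (simp add: field_simps)
    also have "\<dots> = M * (g ^ n) ^ k" 
      by (simp only: M_def power_mult_distrib[of "24 * R1 / sqrt n" "g ^ k"] power_mult[symmetric] mult.commute[of k n])
    also have "\<dots> \<le> M * 3 ^ k"
      using g gn R1_nonneg by (intro mult_left_mono power_mono) (auto simp: M_def)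
    finally show ?thesis .
  qed
  then have "(4 / 3) ^ k \<le> M" for k
    by (simp add: power_divide field_simps)
  moreover obtain k where "M < (4 / 3) ^ k" using real_arch_pow[of "4/3" M] by auto
  ultimately show False by (meson not_le)
qed

text \<open>The translates of the slice lie at different heights of the functional \<open>a\<close>,
  so they are disjoint and pack into one ball.\<close>

lemma card_slice_translates:
  assumes I: "finite I" and f: "\<And>k. k \<in> I \<Longrightarrow> f k \<in> integer_lattice n"
    and inj: "inj_on (\<lambda>k. \<Sum>i<n. a i * f k i) I"
    and bd: "\<And>x k. x \<in> slice a b R \<Longrightarrow> k \<in> I \<Longrightarrow> qnorm (\<lambda>i. x i + f k i) \<le> R'"
  shows "card (slice a b R) * card I \<le> card (lball R')"
proof -
  have "inj_on (\<lambda>(x, k) i. x i + f k i) (slice a b R \<times> I)"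
  proof (rule inj_onI, clarify)
    fix x k y l
    assume *: "x \<in> slice a b R" "k \<in> I" "y \<in> slice a b R" "l \<in> I"
      and eq: "(\<lambda>i. x i + f k i) = (\<lambda>i. y i + f l i)"
    have e: "x i + f k i = y i + f l i" for i using fun_cong[OF eq] .
    have "(\<Sum>i<n. a i * (x i + f k i)) = (\<Sum>i<n. a i * (y i + f l i))" by (simp add: e)
    then have "(\<Sum>i<n. a i * f k i) = (\<Sum>i<n. a i * f l i)"
      using * by (simp add: slice_def distrib_left sum.distrib)
    then have "k = l" using inj * by (auto dest: inj_onD)
    then show "x = y \<and> k = l" using e by auto
  qed
  moreover have "(\<lambda>i. x i + f k i) \<in> lball R'" if "x \<in> slice a b R" "k \<in> I" for x k
    using f[OF that(2)] bd[OF that] that(1) by (simp add: lball_def slice_def integer_lattice_add)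
  then have "(\<lambda>(x, k) i. x i + f k i) ` (slice a b R \<times> I) \<subseteq> lball R'" by auto
  ultimately have "card (slice a b R \<times> I) \<le> card (lball R')"
    by (rule card_inj_on_le) (rule finite_lball)
  then show ?thesis by (simp add: card_cartesian_product)
qed

subsection \<open>Hyperplane sections\<close>

text \<open>The slice is translated by \<open>k\<close> steps along axis \<open>i\<close> and
  \<open>l \<le> T\<close> steps along axis \<open>j\<close>. By \<open>generic\<close> the
  functional separates all these displacements, which yields about \<open>T\<close> times as many as
  one axis alone. A large \<open>T\<close> later absorbs the crude
  \<open>skew_bound\<close>.\<close>

lemma slice_bound_irrational:
  fixes R :: real
  assumes ij: "i < n" "j < n"
    and generic: "\<And>(m::int) (s::nat). 1 \<le> s \<Longrightarrow> s \<le> T \<Longrightarrow> of_nat s * a j \<noteq> of_int m * a i"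
    and ai: "a i \<noteq> 0"
    and R: "R \<ge> 2 * n * skew_bound * T"
  shows "real (card (slice a b R)) * (R / (2 * n * skew_bound) * T) \<le> card (lball ((1 + 1 / n) * R))"
proof -
  \<comment> \<open>Both \<open>k\<close> and \<open>l\<close> are at most
    \<open>R / (2 * n * skew_bound)\<close>, so a displacement has \<open>qnorm\<close> at most
    \<open>R / n\<close>.\<close>
  define kmax where "kmax = nat \<lfloor>R / (2 * n * skew_bound)\<rfloor>"
  define I where "I = {0..kmax} \<times> {0..T}"
  define f where "f = (\<lambda>(k, l) m. real k * (if m = i then 1 else 0) + real l * (if m = j then 1 else 0))"
  note E = skew_bound_pos
  have "0 \<le> 2 * real n * skew_bound * T" using E by simp
  then have R_nonneg: "R \<ge> 0" using R by linarith
  have val: "(\<Sum>m<n. a m * f (k, l) m) = k * a i + l * a j" for k l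
  proof -
    have "(\<Sum>m<n. a m * f (k, l) m) = (\<Sum>m<n. (if m = i then k * a i else 0) + (if m = j then l * a j else 0))"
      by (rule sum.cong) (auto simp: f_def algebra_simps)
    then show ?thesis using ij by (simp add: sum.distrib)
  qed
  have le: "l \<le> l'" if "l \<le> T" "k * a i + l * a j = k' * a i + l' * a j" for k l k' l' :: nat
  proof (rule ccontr)
    assume "\<not> l \<le> l'"
    then have "1 \<le> l - l'" "l - l' \<le> T" "real (l - l') = real l - real l'" using that(1) by auto
    moreover from this have "real (l - l') * a j = of_int (int k' - int k) * a i"
      using that(2) by (simp add: algebra_simps)
    ultimately show False using generic by blast
  qed
  have inj: "inj_on (\<lambda>k. \<Sum>m<n. a m * f k m) I"
  proof (rule inj_onI, clarify)
    fix k l k' l' assume "(k, l) \<in> I" "(k', l') \<in> I"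
      and eq: "(\<Sum>m<n. a m * f (k, l) m) = (\<Sum>m<n. a m * f (k', l') m)"
    then have "l = l'" using le[of l k k' l'] le[of l' k' k l] unfolding val by (auto simp: I_def)
    then show "k = k' \<and> l = l'" using eq ai unfolding val by simp
  qed
  have bd: "qnorm (\<lambda>i. x i + f k i) \<le> (1 + 1 / n) * R" if x: "x \<in> slice a b R" and k: "k \<in> I" for x k
  proof -
    obtain k1 k2 where kk: "k = (k1, k2)" "k1 \<le> kmax" "k2 \<le> T" using k by (auto simp: I_def)
    have "qnorm (f k) \<le> (real kmax + T) * skew_bound"
      by (rule qnorm_le) (use kk in \<open>auto simp: f_def\<close>)
    also have "\<dots> \<le> (R / (2 * n * skew_bound) + R / (2 * n * skew_bound)) * skew_bound"
    proof (intro mult_right_mono add_mono)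
      show "real kmax \<le> R / (2 * n * skew_bound)" unfolding kmax_def using E R_nonneg by simp
      show "real T \<le> R / (2 * n * skew_bound)" using R E n_pos by (simp add: field_simps)
    qed (use E in auto)
    also have "\<dots> = R / n" using E n_pos by (simp add: field_simps)
    finally have "qnorm (f k) \<le> R / n" .
    moreover have "qnorm x \<le> R" using x by (simp add: slice_def lball_def)
    ultimately show ?thesis using qnorm_triangle[of x "f k"] by (simp add: algebra_simps)
  qed
  have "card (slice a b R) * card I \<le> card (lball ((1 + 1 / n) * R))"
  proof (rule card_slice_translates[OF _ _ inj bd])
    show "f k \<in> integer_lattice n" for k
      using ij by (cases k) (auto simp: integer_lattice_iff f_def)
  qed (auto simp: I_def)
  then have "real (card (slice a b R)) * real (card I) \<le> card (lball ((1 + 1 / n) * R))"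
    by (simp only: of_nat_mult[symmetric] of_nat_le_iff)
  moreover have "R / (2 * n * skew_bound) * T \<le> real (card I)"
  proof -
    have "R / (2 * n * skew_bound) \<le> real (Suc kmax)" unfolding kmax_def by linarith
    then have "R / (2 * n * skew_bound) * T \<le> real (Suc kmax) * real (Suc T)"
      by (intro mult_mono) auto
    then show ?thesis by (simp add: I_def card_cartesian_product algebra_simps)
  qed
  ultimately show ?thesis by (meson mult_left_mono of_nat_0_le_iff order_trans)
qed

text \<open>A slice at height \<open>b \<ge> 0\<close> is pushed towards the origin along the metric normal of its
  hyperplane. The squared radius then grows only by the square of the displacement, so one may
  move by \<open>R / sqrt n\<close> instead of \<open>R / n\<close>: this is the source of the factor \<open>sqrt n\<close>.\<close>

lemma slice_bound_primitive:
  assumes a: "a \<in> integer_lattice n" "a \<noteq> (\<lambda>_. 0)"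
    and v: "v \<in> integer_lattice n" "(\<Sum>i<n. a i * v i) = 1"
  shows "\<exists>R0. \<forall>R\<ge>R0. \<forall>b. real (card (slice a b R)) * (r * R / p) \<le> card (lball ((1 + 1 / n) * R))"
proof -
  have n0: "0 < n" using n_pos by simp
  have split: "(\<Sum>i<n. g i) = g 0 + (\<Sum>i\<in>{1..<n}. g i)" for g :: "nat \<Rightarrow> real"
    using n_pos by (simp add: lessThan_atLeast0 sum.atLeast_Suc_lessThan)
  \<comment> \<open>\<open>z / p\<close> is the dual vector representing \<open>a\<close>: the
    transpose of \<open>skew\<close> maps \<open>z\<close> to \<open>p * a\<close>, which is the
    identity \<open>dual\<close> below. The inner product of \<open>u\<close> and \<open>z\<close>
    is \<open>p * a 0\<close>, so \<open>gap\<close> applies to \<open>z\<close>.\<close>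
  define z where "z i = (if i = 0 then of_int p * a 0 - (\<Sum>j\<in>{1..<n}. of_int (u j) * a j) else a i)" for i
  define N where "N = L2_set z {..<n}"
  \<comment> \<open>The preimage of \<open>z\<close> under \<open>skew\<close>, hence the direction
    orthogonal to the hyperplane in the metric of \<open>qnorm\<close>.\<close>
  define h where "h i = (if i = 0 then z 0 else (z i - of_int (u i) * z 0) / of_int p)" for i
  have aZ: "a i \<in> \<int>" for i using a by (simp add: integer_lattice_iff)
  have z_lattice: "z \<in> integer_lattice n"
    using a n0 by (auto simp: integer_lattice_iff z_def intro!: Ints_diff Ints_mult Ints_sum)
  have z_nonzero: "z \<noteq> (\<lambda>_. 0)"
  proof
    assume "z = (\<lambda>_. 0)"
    then have z: "z i = 0" for i by simp
    then have ai: "a i = 0" if "i \<noteq> 0" for i using that z[of i] by (simp add: z_def)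
    then have "of_int p * a 0 = 0" using z[of 0] by (simp add: z_def)
    then have "a i = 0" for i using ai p_pos by (cases "i = 0") auto
    then show False using a(2) by auto
  qed
  have "sqrt n * r < N"
  proof -
    obtain m where m: "a 0 = of_int m" using aZ by (meson Ints_cases)
    have "(\<Sum>i<n. of_int (u i) * z i) = of_int p * of_int m"
      unfolding split by (simp add: z_def u_0 m)
    then show ?thesis unfolding N_def using gap[OF z_lattice z_nonzero] by blast
  qed
  moreover have "0 < sqrt n * r" using n0 r_pos by simp
  ultimately have N: "sqrt n * r < N" "N > 0" by auto
  have N2: "N^2 = (\<Sum>i<n. z i * z i)"
    by (simp add: N_def L2_set_def sum_nonneg power2_eq_square)
  have dual: "(\<Sum>i<n. z i * skew x i) = of_int p * (\<Sum>i<n. a i * x i)" for x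
  proof -
    have "(\<Sum>i\<in>{1..<n}. z i * skew x i) = (\<Sum>i\<in>{1..<n}. of_int (u i) * a i) * x 0 + of_int p * (\<Sum>i\<in>{1..<n}. a i * x i)"
      unfolding sum_distrib_left sum_distrib_right sum.distrib[symmetric]
      by (rule sum.cong) (auto simp: z_def skew_def algebra_simps)
    then show ?thesis unfolding split by (simp add: z_def skew_def u_0 algebra_simps)
  qed
  have skew_h: "skew h i = z i" for i
    using p_pos u_0 by (auto simp: skew_def h_def)
  have ah: "(\<Sum>i<n. a i * h i) = N^2 / of_int p"
    using dual[of h] p_pos unfolding skew_h N2 by (simp add: field_simps)
  define S where "S = (\<Sum>i<n. \<bar>a i\<bar>)"
  \<comment> \<open>Bounds the \<open>qnorm\<close> of the error made in rounding a real
    displacement to an integer one; for \<open>R \<ge> 2 * n * D\<close> it is at most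
    \<open>R / (2 * n)\<close>.\<close>
  define D where "D = (1 + S * (\<Sum>i<n. \<bar>v i\<bar>)) * skew_bound"
  have S_nonneg: "S \<ge> 0" by (simp add: S_def sum_nonneg)
  have D_nonneg: "D \<ge> 0" unfolding D_def using skew_bound_pos S_nonneg
    by (intro mult_nonneg_nonneg add_nonneg_nonneg sum_nonneg) auto
  have main: "real (card (slice a b R)) * (r * R / p) \<le> card (lball ((1 + 1 / n) * R))"
    if R: "R \<ge> 2 * n * D" for R b
  proof (cases "slice a b R = {}")
    case True
    then show ?thesis by simp
  next
    case False
    have "0 \<le> 2 * real n * D" using D_nonneg by simp
    then have R_nonneg: "R \<ge> 0" using R by linarith
    \<comment> \<open>The sign of the height \<open>b\<close>, so that the cross term in the squared
      norm below only helps.\<close>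
    define \<sigma> where "\<sigma> = (if b \<ge> 0 then 1 else - 1 :: real)"
    have \<sigma>: "\<sigma> * \<sigma> = 1" "\<sigma> * b \<ge> 0" "\<sigma> \<in> \<int>" "\<sigma> \<noteq> 0" by (auto simp: \<sigma>_def)
    \<comment> \<open>The real displacement \<open>y k\<close> has \<open>qnorm\<close> equal to
      \<open>k * p / N\<close>, which is at most \<open>R / sqrt n\<close> for
      \<open>k \<le> kmax\<close>.\<close>
    define kmax where "kmax = nat \<lfloor>N * R / (of_int p * sqrt n)\<rfloor>"
    \<comment> \<open>As \<open>a\<close> has the value \<open>N^2 / p\<close> on \<open>h\<close>,
      it has the value \<open>- \<sigma> * k\<close> on \<open>y k\<close>.\<close>
    define t where "t k = \<sigma> * real k * (of_int p / N^2)" for k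
    define y where "y k i = - t k * h i" for k i
    \<comment> \<open>Rounding \<open>y k\<close> down spoils this value by the integer
      \<open>e k\<close>; subtracting \<open>e k\<close> times \<open>v\<close> restores it exactly,
      since \<open>a\<close> is 1 on \<open>v\<close>.\<close>
    define e where "e k = (\<Sum>i<n. a i * of_int \<lfloor>y k i\<rfloor>) + \<sigma> * real k" for k
    define f where "f k i = (if i < n then of_int \<lfloor>y k i\<rfloor> - e k * v i else 0)" for k i
    have ay: "(\<Sum>i<n. a i * y k i) = - \<sigma> * real k" for k
    proof -
      have "(\<Sum>i<n. a i * y k i) = - t k * (\<Sum>i<n. a i * h i)"
        unfolding sum_distrib_left y_def by (rule sum.cong) auto
      then show ?thesis unfolding ah t_def using N p_pos by simp
    qed
    have af: "(\<Sum>i<n. a i * f k i) = - \<sigma> * real k" for k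
    proof -
      have "(\<Sum>i<n. a i * f k i) = (\<Sum>i<n. a i * of_int \<lfloor>y k i\<rfloor> - e k * (a i * v i))"
        by (rule sum.cong) (auto simp: f_def algebra_simps)
      also have "\<dots> = (\<Sum>i<n. a i * of_int \<lfloor>y k i\<rfloor>) - e k"
        using v(2) by (simp add: sum_subtractf flip: sum_distrib_left)
      finally show ?thesis by (simp add: e_def)
    qed
    have e_int: "e k \<in> \<int>" for k
      unfolding e_def using aZ \<sigma> by (intro Ints_add Ints_sum Ints_mult) auto
    have e_le: "\<bar>e k\<bar> \<le> S" for k
    proof -
      have "e k = (\<Sum>i<n. a i * (of_int \<lfloor>y k i\<rfloor> - y k i))"
        using ay[of k] by (simp add: e_def algebra_simps sum_subtractf)
      also have "\<bar>\<dots>\<bar> \<le> (\<Sum>i<n. \<bar>a i * (of_int \<lfloor>y k i\<rfloor> - y k i)\<bar>)" by (rule sum_abs)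
      also have "\<dots> \<le> S"
        unfolding S_def abs_mult by (intro sum_mono mult_left_le) linarith+
      finally show ?thesis .
    qed
    have bd: "qnorm (\<lambda>i. x i + f k i) \<le> (1 + 1 / n) * R"
      if x: "x \<in> slice a b R" and k: "k \<in> {0..kmax}" for x k
    proof -
      define w where "w i = f k i - y k i" for i
      have "qnorm w \<le> D"
        unfolding D_def
      proof (rule qnorm_le)
        fix i assume i: "i < n"
        have "w i = (of_int \<lfloor>y k i\<rfloor> - y k i) - e k * v i"
          using i by (simp add: w_def f_def)
        then have "\<bar>w i\<bar> \<le> \<bar>of_int \<lfloor>y k i\<rfloor> - y k i\<bar> + \<bar>e k\<bar> * \<bar>v i\<bar>"
          unfolding abs_mult[symmetric] by (simp only: abs_triangle_ineq4)
        also have "\<dots> \<le> 1 + S * (\<Sum>i<n. \<bar>v i\<bar>)"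
        proof (intro add_mono mult_mono e_le)
          show "\<bar>of_int \<lfloor>y k i\<rfloor> - y k i\<bar> \<le> 1" by linarith
          show "\<bar>v i\<bar> \<le> (\<Sum>i<n. \<bar>v i\<bar>)" using i by (intro member_le_sum) auto
        qed (use S_nonneg in auto)
        finally show "\<bar>w i\<bar> \<le> 1 + S * (\<Sum>i<n. \<bar>v i\<bar>)" .
      qed
      also have "D \<le> R / (2 * n)" using R n0 by (simp add: field_simps)
      finally have w: "qnorm w \<le> R / (2 * n)" .
      have xR: "qnorm x \<le> R" and xb: "(\<Sum>i<n. a i * x i) = b"
        using x by (auto simp: slice_def lball_def)
      have sk: "skew (\<lambda>i. x i + y k i) i = skew x i - t k * z i" for i
      proof -
        have "skew (\<lambda>i. x i + y k i) i = skew x i + skew (y k) i" by (simp add: skew_add)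
        also have "skew (y k) = (\<lambda>i. - t k * skew h i)"
          unfolding y_def[abs_def] by (rule skew_scale)
        finally show ?thesis by (simp add: skew_h)
      qed
      have "(qnorm (\<lambda>i. x i + y k i))^2 = (\<Sum>i<n. (skew x i - t k * z i)^2)"
        by (simp add: qnorm_def L2_set_def sum_nonneg sk)
      also have "\<dots> = (\<Sum>i<n. (skew x i)^2) - 2 * t k * (\<Sum>i<n. z i * skew x i) + (t k)^2 * (\<Sum>i<n. z i * z i)"
        unfolding sum_distrib_left sum_subtractf[symmetric] sum.distrib[symmetric]
        by (rule sum.cong) (auto simp: power2_eq_square algebra_simps)
      also have "(\<Sum>i<n. (skew x i)^2) = (qnorm x)^2"
        by (simp add: qnorm_def L2_set_def sum_nonneg)
      also have "(\<Sum>i<n. z i * skew x i) = of_int p * b" unfolding dual xb ..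
      also have "(\<Sum>i<n. z i * z i) = N^2" by (simp add: N2)
      also have "(qnorm x)^2 - 2 * t k * (of_int p * b) + (t k)^2 * N^2 \<le> R^2 - 0 + R^2 / n"
      proof (intro add_mono diff_mono)
        show "(qnorm x)^2 \<le> R^2" using xR by (intro power_mono) (auto simp: qnorm_def)
        have "2 * t k * (of_int p * b) = 2 * (\<sigma> * b) * (real k * (of_int p * of_int p / N^2))"
          by (simp add: t_def)
        also have "\<dots> \<ge> 0"
          by (rule mult_nonneg_nonneg[OF mult_nonneg_nonneg[OF _ \<sigma>(2)]]) simp_all
        finally show "0 \<le> 2 * t k * (of_int p * b)" .
        have "real k \<le> real kmax" using k by simp
        also have "\<dots> \<le> N * R / (of_int p * sqrt n)"
          unfolding kmax_def using N R_nonneg p_pos by simp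
        finally have "real k * (of_int p / N) \<le> N * R / (of_int p * sqrt n) * (of_int p / N)"
          using N p_pos by (intro mult_right_mono) auto
        also have "\<dots> = R / sqrt n" using N p_pos by simp
        finally have *: "real k * (of_int p / N) \<le> R / sqrt n" .
        have "(t k)^2 * N^2 = (\<sigma> * \<sigma>) * (real k * (of_int p / N))^2"
          using N by (simp add: t_def power2_eq_square)
        also have "\<dots> \<le> 1 * (R / sqrt n)^2"
          unfolding \<sigma>(1) using * N p_pos by (intro mult_left_mono power_mono) auto
        also have "\<dots> = R^2 / n" by (simp add: power_divide)
        finally show "(t k)^2 * N^2 \<le> R^2 / n" .
      qed
      \<comment> \<open>An increase of the squared radius by \<open>R^2 / n\<close> costs only
        \<open>R / (2 * n)\<close> in the radius; the rounding error takes the other half of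
        \<open>R / n\<close>.\<close>
      also have "\<dots> \<le> (R + R / (2 * n))^2"
        by (simp add: power2_eq_square algebra_simps)
      finally have "qnorm (\<lambda>i. x i + y k i) \<le> R + R / (2 * n)"
        by (rule power2_le_imp_le) (use R_nonneg in simp)
      moreover have "(\<lambda>i. x i + f k i) = (\<lambda>i. (x i + y k i) + w i)" by (simp add: w_def)
      ultimately show ?thesis
        using qnorm_triangle[of "\<lambda>i. x i + y k i" w] w by (simp add: algebra_simps)
    qed
    have "card (slice a b R) * card {0..kmax} \<le> card (lball ((1 + 1 / n) * R))"
    proof (rule card_slice_translates[OF _ _ _ bd])
      show "f k \<in> integer_lattice n" for k
        using v(1) e_int by (intro integer_latticeI) (auto simp: f_def integer_lattice_iff)
      show "inj_on (\<lambda>k. \<Sum>i<n. a i * f k i) {0..kmax}"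
        unfolding af using \<sigma>(4) by (auto simp: inj_on_def)
    qed auto
    then have "real (card (slice a b R)) * real (card {0..kmax}) \<le> card (lball ((1 + 1 / n) * R))"
      by (simp only: of_nat_mult[symmetric] of_nat_le_iff)
    moreover have "r * R / p \<le> real (card {0..kmax})"
    proof -
      \<comment> \<open>The gap \<open>N > sqrt n * r\<close> cancels the \<open>sqrt n\<close> in
        the denominator of \<open>kmax\<close>.\<close>
      have "r * R / p = (sqrt n * r) * R / (of_int p * sqrt n)" using n0 p_pos by (simp add: field_simps)
      also have "\<dots> \<le> N * R / (of_int p * sqrt n)"
        using N R_nonneg p_pos by (intro divide_right_mono mult_right_mono) auto
      also have "\<dots> \<le> real (Suc kmax)" unfolding kmax_def by linarith
      finally show ?thesis by simp
    qed
    ultimately show ?thesis by (meson mult_left_mono of_nat_0_le_iff order_trans)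
  qed
  then show ?thesis by blast
qed

end

text \<open>Bezout for integer vectors: \<open>d\<close> is the least positive value of the functional \<open>a\<close>.\<close>

lemma integer_vector_primitive:
  assumes a: "a \<in> integer_lattice n" "a \<noteq> (\<lambda>_. 0)"
  obtains d a' v where "d > 0" "a = (\<lambda>i. d * a' i)" "a' \<in> integer_lattice n" "a' \<noteq> (\<lambda>_. 0)"
    "v \<in> integer_lattice n" "(\<Sum>i<n. a' i * v i) = 1"
proof -
  have floor: "of_int \<lfloor>a i\<rfloor> = a i" for i
    using a by (auto simp: integer_lattice_iff elim!: Ints_cases)
  define P where "P g \<longleftrightarrow> (\<exists>v\<in>integer_lattice n. (\<Sum>i<n. a i * v i) = of_int g)" for g :: int
  have add: "P (g + k * h)" if gh: "P g" "P h" for g h k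
  proof -
    obtain v w where v: "v \<in> integer_lattice n" "(\<Sum>i<n. a i * v i) = of_int g"
      and w: "w \<in> integer_lattice n" "(\<Sum>i<n. a i * w i) = of_int h"
      using gh by (auto simp: P_def)
    have "(\<Sum>i<n. a i * (v i + of_int k * w i)) = (\<Sum>i<n. a i * v i) + of_int k * (\<Sum>i<n. a i * w i)"
      unfolding sum_distrib_left sum.distrib[symmetric] by (rule sum.cong) (auto simp: algebra_simps)
    then have "(\<Sum>i<n. a i * (v i + of_int k * w i)) = of_int (g + k * h)" using v w by simp
    moreover have "(\<lambda>i. v i + of_int k * w i) \<in> integer_lattice n"
      using v w by (auto simp: integer_lattice_iff)
    ultimately show ?thesis unfolding P_def by (rule bexI)
  qed
  have coord: "P \<lfloor>a i\<rfloor>" for i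
  proof (cases "i < n")
    case True
    have "(\<Sum>j<n. a j * (if j = i then 1 else 0)) = a i" using True by (simp add: if_distrib cong: if_cong)
    moreover have "(\<lambda>j. if j = i then 1 else 0) \<in> integer_lattice n"
      using True by (auto simp: integer_lattice_iff)
    ultimately show ?thesis unfolding P_def floor by (rule bexI)
  next
    case False
    then have "a i = 0" using a by (simp add: integer_lattice_iff)
    moreover have "(\<lambda>_. 0) \<in> integer_lattice n" by (simp add: integer_lattice_iff)
    moreover have "(\<Sum>j<n. a j * 0) = of_int \<lfloor>a i\<rfloor>" using \<open>a i = 0\<close> by simp
    ultimately show ?thesis unfolding P_def by (intro bexI)
  qed
  obtain i where i: "a i \<noteq> 0" using a by auto
  have P0: "P 0" using add[OF coord[of i] coord[of i], of "-1"] by simp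
  have "P \<bar>\<lfloor>a i\<rfloor>\<bar>" using coord[of i] add[OF P0 coord[of i], of "-1"] by (simp add: abs_if)
  moreover have "\<lfloor>a i\<rfloor> \<noteq> 0" using i floor[of i] by auto
  ultimately have ex: "0 < nat \<bar>\<lfloor>a i\<rfloor>\<bar> \<and> P (int (nat \<bar>\<lfloor>a i\<rfloor>\<bar>))" by simp
  define m where "m = (LEAST m. 0 < m \<and> P (int m))"
  have m: "0 < m" "P (int m)" using LeastI[of "\<lambda>m. 0 < m \<and> P (int m)", OF ex] by (auto simp: m_def)
  \<comment> \<open>A nonzero remainder would be a smaller positive value of the functional.\<close>
  have "int m dvd \<lfloor>a j\<rfloor>" for j
  proof (rule ccontr)
    assume "\<not> int m dvd \<lfloor>a j\<rfloor>"
    then have "\<lfloor>a j\<rfloor> mod int m \<noteq> 0" by (simp add: dvd_eq_mod_eq_0)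
    moreover have "0 \<le> \<lfloor>a j\<rfloor> mod int m" "\<lfloor>a j\<rfloor> mod int m < int m" using m by auto
    moreover have "P (\<lfloor>a j\<rfloor> mod int m)"
      using add[OF coord[of j] m(2), of "- (\<lfloor>a j\<rfloor> div int m)"]
      by (simp add: minus_mult_div_eq_mod[symmetric] mult.commute)
    ultimately have "0 < nat (\<lfloor>a j\<rfloor> mod int m) \<and> P (int (nat (\<lfloor>a j\<rfloor> mod int m)))" by simp
    then have "m \<le> nat (\<lfloor>a j\<rfloor> mod int m)" unfolding m_def by (rule Least_le)
    then show False using \<open>\<lfloor>a j\<rfloor> mod int m < int m\<close> \<open>0 \<le> \<lfloor>a j\<rfloor> mod int m\<close> by linarith
  qed
  then have "\<exists>c. \<lfloor>a j\<rfloor> = int m * c" for j by (auto simp: dvd_def)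
  then obtain c where c: "\<And>j. \<lfloor>a j\<rfloor> = int m * c j" by metis
  have aj: "a j = real m * of_int (c j)" for j using floor[of j] c[of j] by simp
  obtain v where v: "v \<in> integer_lattice n" "(\<Sum>i<n. a i * v i) = real m" using m by (auto simp: P_def)
  show thesis
  proof (rule that[of "real m" "\<lambda>j. of_int (c j)" v])
    show "(\<lambda>j. of_int (c j)) \<in> integer_lattice n"
      using a aj m by (auto simp: integer_lattice_iff)
    show "(\<lambda>j. real_of_int (c j)) \<noteq> (\<lambda>_. 0)"
      using i aj[of i] by (auto dest: fun_cong[of _ _ i])
    have "real m * (\<Sum>i<n. of_int (c i) * v i) = real m"
      using v(2) unfolding sum_distrib_left by (simp add: aj mult.assoc)
    then show "(\<Sum>i<n. of_int (c i) * v i) = 1" using m by simp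
  qed (use m aj v in auto)
qed

section \<open>Arbitrary normals and the choice of the radius\<close>

context skew_lattice
begin

lemma slice_scale:
  assumes "d \<noteq> 0"
  shows "slice (\<lambda>i. d * a i) b R = slice a (b / d) R"
proof -
  have "(\<Sum>i<n. d * a i * x i) = d * (\<Sum>i<n. a i * x i)" for x
    by (simp add: sum_distrib_left mult.assoc)
  then show ?thesis using assms by (auto simp: slice_def field_simps)
qed

text \<open>Passing to a primitive normal changes only the height, and the primitive bound is
  uniform in the height.\<close>

lemma slice_bound_rational:
  assumes a: "a \<in> integer_lattice n" "a \<noteq> (\<lambda>_. 0)"
  shows "\<exists>R0. \<forall>R\<ge>R0. \<forall>b. real (card (slice a b R)) * (r * R / p) \<le> card (lball ((1 + 1 / n) * R))"
proof -
  obtain d a' v where d: "d > 0" "a = (\<lambda>i. d * a' i)" "a' \<in> integer_lattice n" "a' \<noteq> (\<lambda>_. 0)"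
    "v \<in> integer_lattice n" "(\<Sum>i<n. a' i * v i) = 1"
    by (rule integer_vector_primitive[OF a])
  have "slice a b R = slice a' (b / d) R" for b R
    unfolding d(2) using d(1) by (intro slice_scale) auto
  then show ?thesis using slice_bound_primitive[OF d(3-6)] by (simp only:) blast
qed

text \<open>Hyperplanes with a generic normal are handled directly. Up to scaling, the others have an
  integer normal with entries at most \<open>T!\<close>, and there are only finitely many of those.\<close>

lemma slice_bound:
  "\<exists>R0. \<forall>R\<ge>R0. \<forall>a b. (\<forall>i\<ge>n. a i = 0) \<longrightarrow> a \<noteq> (\<lambda>_. 0) \<longrightarrow>
     real (card (slice a b R)) * (r * R / p) \<le> card (lball ((1 + 1 / n) * R))"
proof -
  \<comment> \<open>Large enough that the bound of \<open>slice_bound_irrational\<close> dominates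
    the factor \<open>r * R / p\<close>.\<close>
  define T where "T = nat \<lceil>2 * n * skew_bound * r / of_int p\<rceil> + 1"
  define F where "F = {a \<in> integer_lattice n. (\<forall>i<n. \<bar>a i\<bar> \<le> fact T) \<and> a \<noteq> (\<lambda>_. 0)}"
  have "finite F"
  proof (rule finite_subset)
    have "L2_set a {..<n} \<le> sqrt n * (sqrt n * fact T)" if "a \<in> F" for a
    proof -
      have "L2_set a {..<n} \<le> (\<Sum>i<n. \<bar>a i\<bar>)" by (rule L2_set_le_sum_abs)
      also have "\<dots> \<le> (\<Sum>i<n. fact T)" using that by (intro sum_mono) (auto simp: F_def)
      finally show ?thesis by (simp add: mult.assoc[symmetric])
    qed
    then show "F \<subseteq> {a \<in> integer_lattice n. L2_set a {..<n} \<le> sqrt n * (sqrt n * fact T)}"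
      by (auto simp: F_def)
    have "1 * 1 \<le> sqrt n * fact T"
      using n_pos by (intro mult_mono) (auto simp: fact_ge_1)
    then show "finite {a \<in> integer_lattice n. L2_set a {..<n} \<le> sqrt n * (sqrt n * fact T)}"
      by (intro lattice_ball_count(1)) simp
  qed
  \<comment> \<open>The threshold for \<open>R\<close> depends on the integer normal; finiteness of
    \<open>F\<close> gives a common one.\<close>
  moreover have "\<forall>a\<in>F. \<forall>\<^sub>F R in at_top. \<forall>b.
      real (card (slice a b R)) * (r * R / p) \<le> card (lball ((1 + 1 / n) * R))"
    using slice_bound_rational by (simp add: F_def eventually_at_top_linorder)
  ultimately have "\<forall>\<^sub>F R in at_top. \<forall>a\<in>F. \<forall>b.
      real (card (slice a b R)) * (r * R / p) \<le> card (lball ((1 + 1 / n) * R))"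
    by (rule eventually_ball_finite)
  then obtain R1 where R1: "\<And>R a b. R \<ge> R1 \<Longrightarrow> a \<in> F \<Longrightarrow>
      real (card (slice a b R)) * (r * R / p) \<le> card (lball ((1 + 1 / n) * R))"
    unfolding eventually_at_top_linorder by blast
  define R0 where "R0 = max R1 (2 * n * skew_bound * T)"
  have "real (card (slice a b R)) * (r * R / p) \<le> card (lball ((1 + 1 / n) * R))"
    if R: "R \<ge> R0" and supp: "\<And>i. i \<ge> n \<Longrightarrow> a i = 0" and a: "a \<noteq> (\<lambda>_. 0)" for R a b
  proof -
    have RR: "R \<ge> R1" "R \<ge> 2 * n * skew_bound * T" using R by (auto simp: R0_def)
    have "0 \<le> 2 * real n * skew_bound * T" using skew_bound_pos by simp
    then have R_nonneg: "R \<ge> 0" using RR by linarith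
    \<comment> \<open>Taking \<open>i\<close> as the index of a largest entry makes all ratios
      \<open>a j / a i\<close> at most 1 in absolute value.\<close>
    have "Max ((\<lambda>i. \<bar>a i\<bar>) ` {..<n}) \<in> (\<lambda>i. \<bar>a i\<bar>) ` {..<n}"
      using n_pos by (intro Max_in) (auto simp: lessThan_empty_iff)
    then obtain i where "i < n" "Max ((\<lambda>i. \<bar>a i\<bar>) ` {..<n}) = \<bar>a i\<bar>" by auto
    then have i: "i < n" "\<And>j. j < n \<Longrightarrow> \<bar>a j\<bar> \<le> \<bar>a i\<bar>"
      using Max_ge[of "(\<lambda>i. \<bar>a i\<bar>) ` {..<n}"] by (auto simp del: Max_ge_iff)
    have ai: "a i \<noteq> 0"
    proof
      assume "a i = 0"
      then have "a j = 0" for j using i(2)[of j] supp[of j] by (cases "j < n") auto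
      then show False using a by auto
    qed
    show ?thesis
    proof (cases "\<exists>j<n. \<forall>(m::int) (s::nat). 1 \<le> s \<longrightarrow> s \<le> T \<longrightarrow> of_nat s * a j \<noteq> of_int m * a i")
      case True
      then obtain j where j: "j < n"
        "\<And>(m::int) (s::nat). 1 \<le> s \<Longrightarrow> s \<le> T \<Longrightarrow> of_nat s * a j \<noteq> of_int m * a i" by blast
      have "2 * n * skew_bound * r / of_int p \<le> T" unfolding T_def by linarith
      then have "r * R / p \<le> R / (2 * n * skew_bound) * T"
        using R_nonneg skew_bound_pos n_pos p_pos mult_left_mono[of "2 * n * skew_bound * r / of_int p" T R]
        by (simp add: field_simps)
      then have "real (card (slice a b R)) * (r * R / p) \<le> real (card (slice a b R)) * (R / (2 * n * skew_bound) * T)"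
        by (intro mult_left_mono) auto
      also have "\<dots> \<le> card (lball ((1 + 1 / n) * R))"
        by (rule slice_bound_irrational[OF i(1) j ai RR(2)])
      finally show ?thesis .
    next
      case False
      \<comment> \<open>Every ratio \<open>a j / a i\<close> is rational with a denominator at most
        \<open>T\<close>, so multiplication by \<open>fact T\<close> clears them all.\<close>
      define a' where "a' j = fact T / a i * a j" for j
      have int: "a' j \<in> \<int>" if j: "j < n" for j
      proof -
        obtain m :: int and s :: nat where ms: "1 \<le> s" "s \<le> T" "of_nat s * a j = of_int m * a i"
          using False j by blast
        obtain q :: nat where q: "fact T = s * q" using dvd_fact[OF ms(1,2)] by (auto simp: dvd_def)
        then have q': "fact T = real s * real q" by (metis of_nat_fact of_nat_mult)
        have "a' j = real q * (real s * a j) / a i" by (simp add: a'_def q')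
        also have "\<dots> = of_int (int q * m)" using ai by (simp add: ms(3))
        finally show ?thesis by simp
      qed
      have "a' \<in> F"
      proof -
        have "a' \<in> integer_lattice n" using int by (intro integer_latticeI) (auto simp: a'_def supp)
        moreover have "\<bar>a' j\<bar> \<le> fact T" if "j < n" for j
          using i(2)[OF that] ai by (simp add: a'_def abs_mult field_simps)
        moreover have "a' i \<noteq> 0" using ai by (simp add: a'_def)
        then have "a' \<noteq> (\<lambda>_. 0)" by auto
        ultimately show ?thesis by (simp add: F_def)
      qed
      have "slice a' (fact T / a i * b) R = slice a b R"
        unfolding a'_def[abs_def] using ai by (subst slice_scale) auto
      then show ?thesis using R1[OF RR(1) \<open>a' \<in> F\<close>] by metis
    qed
  qed
  then show ?thesis by blast
qed

text \<open>Let \<open>f\<close> be the number of lattice points, \<open>s\<close> that of a slice,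
  and \<open>P = p powr (1 / n) = 12 * r\<close>. The slice bound at a doubling radius gives
  \<open>s * P * R \<le> 48 * f * p\<close>; the \<open>n\<close>-th root of the volume bound gives
  \<open>f powr (1 / n) * p * sqrt n \<le> 24 * R * P\<close>. In combination \<open>p\<close>,
  \<open>P\<close> and \<open>R\<close> cancel, leaving \<open>48 * 24 = 1152\<close>.\<close>

lemma exists_sparse_ball:
  assumes vol: "(12 * r) ^ n = p"
  shows "\<exists>R\<ge>0. \<forall>a b. (\<forall>i\<ge>n. a i = 0) \<longrightarrow> a \<noteq> (\<lambda>_. 0) \<longrightarrow>
    real (card (slice a b R)) * sqrt n \<le> 1152 * real (card (lball R)) powr ((real n - 1) / n)"
proof -
  obtain R0 where R0: "\<And>R a b. R \<ge> R0 \<Longrightarrow> (\<forall>i\<ge>n. a i = 0) \<Longrightarrow> a \<noteq> (\<lambda>_. 0) \<Longrightarrow>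
     real (card (slice a b R)) * (r * R / p) \<le> card (lball ((1 + 1 / n) * R))"
    using slice_bound by blast
  obtain R where R: "R \<ge> max R0 (real n * of_int p)"
    and doubling: "real (card (lball ((1 + 1 / n) * R))) \<le> 4 * real (card (lball R))"
    using exists_doubling_radius by blast
  have "0 < real n * of_int p" using n_pos p_pos by simp
  then have R_pos: "R > 0" using R by linarith
  define f where "f = real (card (lball R))"
  have "card (lball R) \<noteq> 0" using zero_in_lball[of R] R_pos finite_lball by auto
  then have f: "f \<ge> 1" unfolding f_def by linarith
  define e where "e = 1 / real n"
  define P where "P = real_of_int p powr e"
  have e: "(real n - 1) / n = 1 - e" "e * n = 1" "e > 0" using n_pos by (auto simp: e_def field_simps)
  have P: "P = 12 * r"
  proof -
    have "real_of_int p = (12 * r) powr real n" using vol r_pos by (simp add: powr_realpow)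
    then show ?thesis using r_pos e unfolding P_def by (simp add: powr_powr mult.commute)
  qed
  have "f * real_of_int p powr (n - 1) \<le> (24 * R / sqrt n) ^ n"
    using card_lball_le[of R] R p_pos by (simp add: f_def powr_realpow)
  then have "(f * real_of_int p powr (n - 1)) powr e \<le> ((24 * R / sqrt n) ^ n) powr e"
    using f e by (intro powr_mono2) auto
  also have "(f * real_of_int p powr (n - 1)) powr e = f powr e * (p / P)"
  proof -
    have "real (n - 1) * e = 1 - e" using e n_pos by (simp add: of_nat_diff algebra_simps)
    then have "(f * real_of_int p powr (n - 1)) powr e = f powr e * real_of_int p powr (1 - e)"
      using f by (simp only: powr_mult powr_powr)
    also have "real_of_int p powr (1 - e) = p / P"
      using p_pos unfolding P_def powr_diff by simp
    finally show ?thesis .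
  qed
  also have "((24 * R / sqrt n) ^ n) powr e = 24 * R / sqrt n"
    using R_pos n_pos e by (simp add: powr_powr mult.commute flip: powr_realpow)
  finally have root: "f powr e * p * sqrt n \<le> 24 * R * P"
    using P r_pos n_pos by (simp add: field_simps)
  have "real (card (slice a b R)) * sqrt n \<le> 1152 * f powr ((real n - 1) / n)"
    if a: "\<forall>i\<ge>n. a i = 0" "a \<noteq> (\<lambda>_. 0)" for a b
  proof -
    define s where "s = real (card (slice a b R))"
    have fe: "f = f powr (1 - e) * f powr e" using f by (simp flip: powr_add)
    have "s * (r * R / p) \<le> 4 * f"
      unfolding s_def f_def using R0[of R a b] R a doubling by simp
    then have "s * (P * R) \<le> 48 * f * p" using p_pos by (simp add: P field_simps)
    then have "s * (P * R) * sqrt n \<le> 48 * f * p * sqrt n" by (intro mult_right_mono) auto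
    also have "\<dots> = 48 * f powr (1 - e) * (f powr e * p * sqrt n)"
      by (subst fe) (simp add: algebra_simps)
    also have "\<dots> \<le> 48 * f powr (1 - e) * (24 * R * P)"
      by (intro mult_left_mono root) auto
    finally have "(s * sqrt n) * (P * R) \<le> (1152 * f powr (1 - e)) * (P * R)" by (simp add: algebra_simps)
    moreover have "P * R > 0" using P r_pos R_pos by simp
    ultimately have "s * sqrt n \<le> 1152 * f powr (1 - e)" by (rule mult_right_le_imp_le)
    then show ?thesis by (simp add: s_def e)
  qed
  then show ?thesis unfolding f_def using R_pos by (intro exI[of _ R]) auto
qed

end

subsection \<open>The ellipsoid as a convex body\<close>

context skew_lattice
begin

definition qball :: "real \<Rightarrow> (nat \<Rightarrow> real) set" where
  "qball R = {x \<in> R_space n. qnorm x \<le> R}"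

text \<open>Solves the triangular system \<open>skew\<close> for its coordinates; any bound will do,
  as it only serves to enclose the ellipsoid in a compact box.\<close>

lemma abs_le_if_qnorm_le:
  assumes "qnorm x \<le> R" "i < n"
  shows "\<bar>x i\<bar> \<le> R + \<bar>of_int (u i)\<bar> * R"
proof -
  have skew_le: "\<bar>skew x j\<bar> \<le> R" if "j < n" for j
    using member_le_L2_set[of "{..<n}" j "\<lambda>j. \<bar>skew x j\<bar>"] that assms(1)
    by (simp add: qnorm_def L2_set_def)
  have x0: "\<bar>x 0\<bar> \<le> R" using skew_le[of 0] n_pos u_0 by (simp add: skew_def)
  show ?thesis
  proof (cases "i = 0")
    case True
    then show ?thesis using x0 u_0 by simp
  next
    case False
    have "1 * \<bar>x i\<bar> \<le> of_int p * \<bar>x i\<bar>" using p_pos by (intro mult_right_mono) auto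
    also have "\<dots> = \<bar>skew x i - of_int (u i) * x 0\<bar>"
      using False p_pos by (simp add: skew_def abs_mult)
    also have "\<dots> \<le> \<bar>skew x i\<bar> + \<bar>of_int (u i)\<bar> * \<bar>x 0\<bar>"
      unfolding abs_mult[symmetric] by (rule abs_triangle_ineq4)
    also have "\<dots> \<le> R + \<bar>of_int (u i)\<bar> * R"
      using skew_le assms(2) x0 by (intro add_mono mult_left_mono) auto
    finally show ?thesis by simp
  qed
qed

text \<open>A closed subset of a compact product of intervals; the factors \<open>{0}\<close> from
  index \<open>n\<close> on keep the box inside \<open>R_space n\<close>.\<close>

lemma compactin_qball: "compactin (Euclidean_space n) (qball R)"
proof -
  define box where "box i = (if i < n then {- (R + \<bar>of_int (u i)\<bar> * R)..R + \<bar>of_int (u i)\<bar> * R} else {0})" for i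
  define B where "B = (\<Pi>\<^sub>E i\<in>UNIV. box i)"
  have "compactin (powertop_real UNIV) B"
    unfolding B_def by (auto simp: compactin_PiE box_def)
  then have "compact B" by (simp add: euclidean_product_topology)
  moreover have "continuous_on UNIV qnorm"
  proof -
    have "continuous_on UNIV (\<lambda>x. skew x i)" for i
      unfolding skew_def by (cases "i = 0") (auto intro!: continuous_intros continuous_on_product_coordinates)
    then show ?thesis
      unfolding qnorm_def[abs_def] L2_set_def by (intro continuous_intros)
  qed
  then have "closed {x. qnorm x \<le> R}"
    by (intro closed_Collect_le) (auto intro: continuous_intros)
  ultimately have "compact (B \<inter> {x. qnorm x \<le> R})" by (rule compact_Int_closed)
  also have "B \<inter> {x. qnorm x \<le> R} = qball R"
  proof (intro equalityI subsetI)
    fix x assume "x \<in> B \<inter> {x. qnorm x \<le> R}"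
    then have x: "x \<in> B" "qnorm x \<le> R" by auto
    have "x i \<in> box i" for i using x(1) unfolding B_def by (rule PiE_mem) simp
    then have "x i = 0" if "i \<ge> n" for i using that by (metis box_def not_le singletonD)
    then show "x \<in> qball R" using x by (simp add: qball_def topspace_Euclidean_space)
  next
    fix x assume x: "x \<in> qball R"
    have "x i \<in> box i" for i
    proof (cases "i < n")
      case True
      then have "\<bar>x i\<bar> \<le> R + \<bar>of_int (u i)\<bar> * R"
        using x by (intro abs_le_if_qnorm_le) (auto simp: qball_def)
      then show ?thesis using True by (simp add: box_def abs_le_iff)
    next
      case False
      then show ?thesis using x by (simp add: box_def qball_def topspace_Euclidean_space)
    qed
    then show "x \<in> B \<inter> {x. qnorm x \<le> R}"
      using x by (simp add: B_def qball_def PiE_iff)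
  qed
  finally show ?thesis
    unfolding Euclidean_space_def compactin_subtopology euclidean_product_topology compactin_euclidean_iff
    by (simp add: qball_def subset_iff topspace_Euclidean_space)
qed

lemma convex_set_qball: "convex_set (qball R)"
  unfolding convex_set_def
proof (intro ballI allI impI)
  fix x y and s t :: real
  assume x: "x \<in> qball R" and y: "y \<in> qball R" and st: "0 \<le> s" "0 \<le> t" "s + t = 1"
  have "qnorm (\<lambda>i. s * x i + t * y i) \<le> s * qnorm x + t * qnorm y"
    using qnorm_triangle[of "\<lambda>i. s * x i" "\<lambda>i. t * y i"] st by (simp add: qnorm_scale)
  also have "\<dots> \<le> s * R + t * R"
    using x y st by (intro add_mono mult_left_mono) (auto simp: qball_def)
  also have "\<dots> = R" using st by (simp flip: distrib_right)
  finally show "(\<lambda>i. s * x i + t * y i) \<in> qball R"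
    using x y by (simp add: qball_def topspace_Euclidean_space)
qed

lemma origin_symmetric_qball: "origin_symmetric (qball R)"
proof -
  have neg: "(\<lambda>i. - x i) \<in> qball R" if "x \<in> qball R" for x
    using that qnorm_scale[of "-1" x] by (simp add: qball_def topspace_Euclidean_space)
  have "x \<in> (\<lambda>x i. - x i) ` qball R" if "x \<in> qball R" for x
    by (rule image_eqI[OF _ neg[OF that]]) simp
  then show ?thesis unfolding origin_symmetric_def using neg by auto
qed

lemma lattice_count_qball: "lattice_count n (qball R) = card (lball R)"
  unfolding lattice_count_def
  by (rule arg_cong[where f = card]) (auto simp: qball_def lball_def integer_lattice_def)

lemma lattice_count_hyperplane:
  "lattice_count n (qball R \<inter> {x \<in> R_space n. (\<Sum>i<n. a i * x i) = b}) = card (slice a b R)"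
  unfolding lattice_count_def
  by (rule arg_cong[where f = card]) (auto simp: qball_def lball_def slice_def integer_lattice_def)

text \<open>The hyperplane \<open>x 0 = 0\<close> contains the origin, so the supremum is at least 1
  and the denominator of the final quotient is positive. \<open>M\<close> also supplies the
  boundedness that \<open>cSUP_upper\<close> needs.\<close>

lemma max_hyperplane_count_qball:
  assumes R: "R \<ge> 0"
    and M: "\<And>a b. (\<forall>i\<ge>n. a i = 0) \<Longrightarrow> a \<noteq> (\<lambda>_. 0) \<Longrightarrow> real (card (slice a b R)) \<le> M"
  shows "max_hyperplane_count n (qball R) \<le> M" "max_hyperplane_count n (qball R) \<ge> 1"
proof -
  define e where "e = (\<lambda>i::nat. if i = 0 then 1 else 0 :: real)"
  define H where "H = {x \<in> R_space n. (\<Sum>i<n. e i * x i) = 0}"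
  have "e 0 \<noteq> 0" by (simp add: e_def)
  then have "e \<noteq> (\<lambda>_. 0)" by auto
  moreover have "e \<in> R_space n" using n_pos by (simp add: e_def topspace_Euclidean_space)
  ultimately have H: "affine_hyperplane n H"
    unfolding affine_hyperplane_def H_def by blast
  have le: "real (lattice_count n (qball R \<inter> H)) \<le> M" if hyp: "affine_hyperplane n H" for H
  proof -
    obtain a b where "a \<in> R_space n" "a \<noteq> (\<lambda>_. 0)" and eq: "H = {x \<in> R_space n. (\<Sum>i<n. a i * x i) = b}"
      using hyp unfolding affine_hyperplane_def by blast
    then show ?thesis
      unfolding eq lattice_count_hyperplane by (intro M) (auto simp: topspace_Euclidean_space)
  qed
  show "max_hyperplane_count n (qball R) \<le> M"
    unfolding max_hyperplane_count_def using H le by (intro cSUP_least) auto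
  have "(\<lambda>_. 0) \<in> slice e 0 R" using zero_in_lball[OF R] by (simp add: slice_def)
  moreover have "finite (slice e 0 R)"
    by (rule finite_subset[OF _ finite_lball]) (auto simp: slice_def)
  ultimately have "card (slice e 0 R) > 0" by (auto simp: card_gt_0_iff)
  then have "1 \<le> real (lattice_count n (qball R \<inter> H))"
    unfolding H_def lattice_count_hyperplane by simp
  also have "\<dots> \<le> max_hyperplane_count n (qball R)"
    unfolding max_hyperplane_count_def using H le by (intro cSUP_upper bdd_aboveI2) auto
  finally show "max_hyperplane_count n (qball R) \<ge> 1" .
qed

end

section \<open>Assembly of the body and the sequence\<close>

lemma exists_sparse_body:
  assumes n: "n \<ge> (1::nat)"
  shows "\<exists>K. K \<noteq> {} \<and> convex_body n K \<and> origin_symmetric K \<and>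
    1 / 1152 * sqrt n \<le> real (lattice_count n K) powr ((real n - 1) / real n) / max_hyperplane_count n K"
proof -
  obtain p u r where pur: "prime p" "u 0 = 1" "r \<ge> 1" "(12 * r) ^ n = of_int p"
    "\<And>x m. x \<in> integer_lattice n \<Longrightarrow> x \<noteq> (\<lambda>_. 0) \<Longrightarrow>
      (\<Sum>i<n. of_int (u i) * x i) = of_int p * of_int m \<Longrightarrow> sqrt n * r < L2_set x {..<n}"
    by (rule exists_dual_gap[OF n]) blast
  interpret skew_lattice n p u r
  proof
    show "p > 0" "r > 0" using pur(1,3) by (simp_all add: prime_gt_0_int)
  qed (fact n pur)+
  obtain R where R: "R \<ge> 0" and slices: "\<And>a b. (\<forall>i\<ge>n. a i = 0) \<Longrightarrow> a \<noteq> (\<lambda>_. 0) \<Longrightarrow>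
      real (card (slice a b R)) * sqrt n \<le> 1152 * real (card (lball R)) powr ((real n - 1) / n)"
    using exists_sparse_ball[OF pur(4)] by blast
  define F where "F = real (card (lball R)) powr ((real n - 1) / n)"
  have "real (card (slice a b R)) \<le> 1152 * F / sqrt n"
    if "\<forall>i\<ge>n. a i = 0" "a \<noteq> (\<lambda>_. 0)" for a b
    using slices[OF that, of b] n by (simp add: F_def field_simps)
  note max = max_hyperplane_count_qball[OF R this]
  have "1 / 1152 * sqrt n \<le> F / max_hyperplane_count n (qball R)"
    using max n by (simp add: field_simps)
  moreover have "(\<lambda>_. 0) \<in> qball R" using R by (simp add: qball_def topspace_Euclidean_space)
  ultimately show ?thesis
    using compactin_qball convex_set_qball origin_symmetric_qball
    by (intro exI[of _ "qball R"]) (auto simp: convex_body_def lattice_count_qball F_def)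
qed

theorem theorem1p5:
  shows "\<exists>c::real. c > 0 \<and>
    (\<forall>n::nat. n \<ge> 1 \<longrightarrow>
      (\<exists>K :: nat \<Rightarrow> (nat \<Rightarrow> real) set.
        (\<forall>j. K j \<noteq> {} \<and> convex_body n (K j) \<and> origin_symmetric (K j)) \<and>
        limsup (\<lambda>j. ereal (real (lattice_count n (K j)) powr ((real n - 1) / real n)
                            / max_hyperplane_count n (K j)))
          \<ge> ereal (c * sqrt (real n))))"
proof (rule exI[of _ "1 / 1152"], intro conjI allI impI)
  show "0 < (1 / 1152 :: real)" by simp
next
  fix n :: nat assume "n \<ge> 1"
  then obtain K where "K \<noteq> {} \<and> convex_body n K \<and> origin_symmetric K"
    "1 / 1152 * sqrt n \<le> real (lattice_count n K) powr ((real n - 1) / real n) / max_hyperplane_count n K"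
    using exists_sparse_body by blast
  then show "\<exists>K :: nat \<Rightarrow> (nat \<Rightarrow> real) set.
        (\<forall>j. K j \<noteq> {} \<and> convex_body n (K j) \<and> origin_symmetric (K j)) \<and>
        limsup (\<lambda>j. ereal (real (lattice_count n (K j)) powr ((real n - 1) / real n)
                            / max_hyperplane_count n (K j)))
          \<ge> ereal (1 / 1152 * sqrt (real n))"
    \<comment> \<open>One body serves for every \<open>j\<close>, so the limsup is that of a
      constant sequence.\<close>
    by (intro exI[of _ "\<lambda>_. K"]) (simp add: Limsup_const)
qed

end
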